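(* Let $X$ be a $T_0$ topological space and let $\delta=\max(\operatorname{sm}(X),\log(|X|))$. If $\delta$ is $\log(|X|)$-decomposable, then $\operatorname{ps}(X)=\delta$.
   Context: Games ($X$ a topological space, $Y\subseteq X$, $\beta$ an ordinal): two players, Seeker and Hider, make $\beta$ moves. At move $\alpha<\beta$, knowing all previous moves, the Seeker chooses an open set $U_\alpha\subseteq X$, and then the Hider chooses $V_\alpha\in\{U_\alpha, X\setminus U_\alpha\}$. The outcome is $W=\bigcap_{\alpha<\beta}V_\alpha$ (with $W=X$ if $\beta=0$). In the point separating game $G_\beta(X)$ the Seeker wins iff $|W|\le 1$. In the set membership game $G_\beta(Y,X)$ the Seeker wins iff $W\subseteq Y$ or $W\cap Y=\emptyset$. For a $T_0$ space $X$: $\operatorname{ps}(X)$ is the least ordinal $\beta$ such that the Seeker has a winning strategy in $G_\beta(X)$; $\operatorname{sm}(Y,X)$ is the least ordinal $\beta$ such that the Seeker has a winning strategy in $G_\beta(Y,X)$; $\operatorname{sm}(X)=\sup\{\operatorname{sm}(Y,X):Y\subseteq X\}$. These are ordinals, not necessarily cardinals. For a cardinal $\kappa$, $\log(\kappa)=\min\{\lambda: 2^\lambda\ge\kappa\}$ (minimum over cardinals). An ordinal $\alpha$ is $\kappa$-decomposable ($\kappa$ a cardinal) if $\alpha$ can be partitioned into $\kappa$ subsets, each of order type $\alpha$. *)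

theory Defs
  imports "HOL-Analysis.Analysis"
begin

unbundle cardinal_syntax
no_notation Set_Algebras.elt_set_eq (infix "=o" 50)

section \<open>Ordinals\<close>

text \<open>
  An element of \<open>'b ordinal\<close> is the order type of a well-order on a subset of \<open>'b\<close>. This type
  represents an initial segment of the class of all ordinals, namely the ordinals of cardinality
  at most that of \<open>'b\<close>. Consequently the least ordinal with a given property agrees with the
  least element of \<open>'b ordinal\<close> with that property, as soon as \<open>'b ordinal\<close> contains one.
\<close>

quotient_type 'b ordinal = "'b rel" / partial: "\<lambda>r s :: 'b rel. r =o s"
proof (rule part_equivpI)
  show "\<exists>r :: 'b rel. r =o r"
    by (rule exI[of _ "|UNIV|"]) (rule card_of_refl)
  show "symp (\<lambda>r s :: 'b rel. r =o s)"
    by (rule sympI) (rule ordIso_symmetric)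
  show "transp (\<lambda>r s :: 'b rel. r =o s)"
    by (rule transpI) (rule ordIso_transitive)
qed

instantiation ordinal :: (type) wellorder
begin

lift_definition less_eq_ordinal :: "'a ordinal \<Rightarrow> 'a ordinal \<Rightarrow> bool" is "\<lambda>r s. r \<le>o s"
proof (rule iffI)
  fix r r' s s' :: "'a rel"
  assume "r =o r'" "s =o s'"
  show "r' \<le>o s'" if "r \<le>o s"
    by (rule ordLeq_ordIso_trans[OF ordIso_ordLeq_trans[OF ordIso_symmetric[OF \<open>r =o r'\<close>] that] \<open>s =o s'\<close>])
  show "r \<le>o s" if "r' \<le>o s'"
    by (rule ordLeq_ordIso_trans[OF ordIso_ordLeq_trans[OF \<open>r =o r'\<close> that] ordIso_symmetric[OF \<open>s =o s'\<close>]])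
qed

lift_definition less_ordinal :: "'a ordinal \<Rightarrow> 'a ordinal \<Rightarrow> bool" is "\<lambda>r s. r <o s"
proof (rule iffI)
  fix r r' s s' :: "'a rel"
  assume "r =o r'" "s =o s'"
  show "r' <o s'" if "r <o s"
    by (rule ordLess_ordIso_trans[OF ordIso_ordLess_trans[OF ordIso_symmetric[OF \<open>r =o r'\<close>] that] \<open>s =o s'\<close>])
  show "r <o s" if "r' <o s'"
    by (rule ordLess_ordIso_trans[OF ordIso_ordLess_trans[OF \<open>r =o r'\<close> that] ordIso_symmetric[OF \<open>s =o s'\<close>]])
qed

instance
proof
  fix x y z :: "'a ordinal"
  have wo: "Well_order r" if "r =o r" for r :: "'a rel"
    using that by (simp add: ordIso_def)
  show "(x < y) = (x \<le> y \<and> \<not> y \<le> x)"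
  proof transfer
    fix r s :: "'a rel" assume "r =o r" "s =o s"
    then have "\<not> s \<le>o r \<longleftrightarrow> r <o s"
      by (intro not_ordLeq_iff_ordLess wo)
    then show "(r <o s) = (r \<le>o s \<and> \<not> s \<le>o r)"
      using ordLess_imp_ordLeq[of r s] by argo
  qed
  show "x \<le> x"
    by transfer (rule ordLeq_reflexive[OF wo])
  show "x \<le> y \<Longrightarrow> y \<le> z \<Longrightarrow> x \<le> z"
    by transfer (rule ordLeq_transitive)
  show "x \<le> y \<Longrightarrow> y \<le> x \<Longrightarrow> x = y"
    by transfer (simp only: ordIso_iff_ordLeq simp_thms)
  show "x \<le> y \<or> y \<le> x"
    by transfer (rule ordLeq_total[OF wo wo])
next
  fix P :: "'a ordinal \<Rightarrow> bool" and a :: "'a ordinal"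
  assume step: "\<And>x. (\<And>y. y < x \<Longrightarrow> P y) \<Longrightarrow> P x"
  have "wf (inv_image ordLess rep_ordinal :: 'a ordinal rel)"
    by (intro wf_inv_image wf_ordLess)
  then show "P a"
  proof (induction a rule: wf_induct_rule)
    case (less x)
    show ?case
    proof (rule step)
      fix y assume "y < x"
      then show "P y"
        by (intro less) (simp only: less_ordinal.rep_eq in_inv_image)
    qed
  qed
qed

end

lift_definition ord_type :: "'b rel \<Rightarrow> 'b ordinal" is
  "\<lambda>r. if Well_order r then r else {}"
proof -
  fix r :: "'b rel"
  have "Well_order ({} :: 'b rel)"
    by (simp add: well_order_on_empty)
  then show "(if Well_order r then r else {}) =o (if Well_order r then r else {})"
    by (simp add: ordIso_reflexive)
qed

lemma ord_type_cases:
  obtains r where "Well_order r" "\<alpha> = ord_type r"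
proof -
  have "Well_order (rep_ordinal \<alpha>)"
    using Quotient3_rep_reflp[OF Quotient3_ordinal, of \<alpha>] by (simp add: ordIso_def)
  moreover from this have "\<alpha> = ord_type (rep_ordinal \<alpha>)"
    using Quotient3_abs_rep[OF Quotient3_ordinal, of \<alpha>] by (simp add: ord_type_def)
  ultimately show ?thesis by (rule that)
qed

text \<open>
  An ordinal is identified with the set \<open>{..<\<beta>}\<close> of its predecessors, as usual; this is justified
  by the following lemma.
\<close>

lemma ord_type_segment:
  fixes r :: "'b rel"
  assumes r: "Well_order r"
  obtains f where "bij_betw f (Field r) {..<ord_type r}"
    and "\<And>x y. x \<in> Field r \<Longrightarrow> y \<in> Field r \<Longrightarrow> (x, y) \<in> r \<longleftrightarrow> f x \<le> f y"
proof
  let ?R = "\<lambda>x. Restr r (underS r x)"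
  let ?f = "\<lambda>x. ord_type (?R x)"
  have R: "Well_order (?R x)" for x
    using r by (rule Well_order_Restr)
  have le: "ord_type s \<le> ord_type t \<longleftrightarrow> s \<le>o t" if "Well_order s" "Well_order t" for s t :: "'b rel"
    using that by (simp add: less_eq_ordinal.abs_eq ord_type.abs_eq ordIso_reflexive ord_type_def)
  have less: "ord_type s < ord_type t \<longleftrightarrow> s <o t" if "Well_order s" "Well_order t" for s t :: "'b rel"
    using that by (simp add: le not_ordLeq_iff_ordLess flip: not_le)
  show iff: "(x, y) \<in> r \<longleftrightarrow> ?f x \<le> ?f y" if "x \<in> Field r" "y \<in> Field r" for x y
  proof -
    have "wo_rel r" using r by (simp add: wo_rel_def)
    then have "?f x \<le> ?f y \<longleftrightarrow> underS r x \<subseteq> underS r y"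
      using ofilter_subset_ordLeq[OF r] by (simp add: le R wo_rel.underS_ofilter)
    also have "\<dots> \<longleftrightarrow> (x, y) \<in> r"
      using r that by (intro underS_incl_iff) (auto simp: well_order_on_def)
    finally show ?thesis ..
  qed
  have "inj_on ?f (Field r)"
  proof (rule inj_onI)
    fix x y assume "x \<in> Field r" "y \<in> Field r" "?f x = ?f y"
    then have "(x, y) \<in> r" "(y, x) \<in> r"
      using iff by auto
    with r show "x = y"
      by (auto simp: order_on_defs antisym_def)
  qed
  moreover have "?f ` Field r = {..<ord_type r}"
  proof (intro equalityI subsetI)
    fix \<alpha> assume "\<alpha> \<in> ?f ` Field r"
    then obtain x where "x \<in> Field r" "\<alpha> = ?f x" by blast
    then show "\<alpha> \<in> {..<ord_type r}"
      using underS_Restr_ordLess[OF r] less[OF R r] by auto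
  next
    fix \<alpha> assume "\<alpha> \<in> {..<ord_type r}"
    moreover obtain s where s: "Well_order s" "\<alpha> = ord_type s"
      by (rule ord_type_cases)
    ultimately have "s <o r" using r by (simp add: less)
    then obtain x where x: "x \<in> Field r" "s =o ?R x"
      using ordLess_iff_ordIso_Restr[OF r s(1)] by blast
    then have "\<alpha> = ?f x"
      using s R by (auto simp: le ordIso_iff_ordLeq intro!: antisym)
    with x show "\<alpha> \<in> ?f ` Field r" by blast
  qed
  ultimately show "bij_betw ?f (Field r) {..<ord_type r}"
    by (simp add: bij_betw_def)
qed

text \<open>Cardinals are the initial ordinals.\<close>

definition is_cardinal :: "'b ordinal \<Rightarrow> bool" where
  "is_cardinal \<mu> \<longleftrightarrow> (\<forall>\<alpha><\<mu>. |{..<\<alpha>}| <o |{..<\<mu>}| )"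

text \<open>The cardinal \<open>\<kappa>\<close> is given as a cardinal order, e.g. \<open>|A|\<close>.\<close>

definition clog :: "'c rel \<Rightarrow> 'b ordinal" where
  "clog \<kappa> = (LEAST \<mu>. is_cardinal \<mu> \<and> \<kappa> \<le>o ctwo ^c |{..<\<mu>}| )"

definition has_order_type :: "'b ordinal set \<Rightarrow> 'b ordinal \<Rightarrow> bool" where
  "has_order_type A \<alpha> \<longleftrightarrow> (\<exists>f. bij_betw f A {..<\<alpha>} \<and> strict_mono_on A f)"

definition decomposable :: "'b ordinal \<Rightarrow> 'b ordinal \<Rightarrow> bool" where
  "decomposable \<kappa> \<alpha> \<longleftrightarrow>
     (\<exists>P. disjoint P \<and> \<Union>P = {..<\<alpha>} \<and> |P| =o |{..<\<kappa>}| \<and> (\<forall>A\<in>P. has_order_type A \<alpha>))"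

section \<open>The games\<close>

text \<open>
  A strategy \<open>\<sigma>\<close> of the Seeker maps the index \<open>\<alpha>\<close> of the current move and the sequence of all
  previous moves \<open>(U \<xi>, V \<xi>)\<close>, \<open>\<xi> < \<alpha>\<close>, to an open set. It is winning if the outcome of every play
  following \<open>\<sigma>\<close> satisfies the winning condition \<open>win\<close>.
\<close>

definition outcome :: "'a topology \<Rightarrow> 'b ordinal \<Rightarrow> ('b ordinal \<Rightarrow> 'a set) \<Rightarrow> 'a set" where
  "outcome X \<beta> V = topspace X \<inter> (\<Inter>\<alpha>\<in>{..<\<beta>}. V \<alpha>)"

definition play_following ::
  "'a topology \<Rightarrow> 'b ordinal \<Rightarrow> ('b ordinal \<Rightarrow> ('b ordinal \<Rightarrow> 'a set \<times> 'a set) \<Rightarrow> 'a set) \<Rightarrow>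
    ('b ordinal \<Rightarrow> 'a set) \<Rightarrow> ('b ordinal \<Rightarrow> 'a set) \<Rightarrow> bool" where
  "play_following X \<beta> \<sigma> U V \<longleftrightarrow>
     (\<forall>\<alpha><\<beta>. U \<alpha> = \<sigma> \<alpha> (restrict (\<lambda>\<xi>. (U \<xi>, V \<xi>)) {..<\<alpha>}) \<and> V \<alpha> \<in> {U \<alpha>, topspace X - U \<alpha>})"

definition Seeker_wins :: "'a topology \<Rightarrow> 'b ordinal \<Rightarrow> ('a set \<Rightarrow> bool) \<Rightarrow> bool" where
  "Seeker_wins X \<beta> win \<longleftrightarrow>
     (\<exists>\<sigma>. (\<forall>\<alpha> h. openin X (\<sigma> \<alpha> h)) \<and>
          (\<forall>U V. play_following X \<beta> \<sigma> U V \<longrightarrow> win (outcome X \<beta> V)))"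

definition Seeker_wins_separating :: "'a topology \<Rightarrow> 'b ordinal \<Rightarrow> bool" where
  "Seeker_wins_separating X \<beta> \<longleftrightarrow> Seeker_wins X \<beta> (\<lambda>W. finite W \<and> card W \<le> 1)"

definition Seeker_wins_membership :: "'a set \<Rightarrow> 'a topology \<Rightarrow> 'b ordinal \<Rightarrow> bool" where
  "Seeker_wins_membership Y X \<beta> \<longleftrightarrow> Seeker_wins X \<beta> (\<lambda>W. W \<subseteq> Y \<or> W \<inter> Y = {})"

text \<open>
  Ordinals of cardinality at most \<open>max |'a| \<aleph>\<^sub>0\<close> suffice for the definitions below; the lemmas
  following them show that all the minima and the supremum exist for \<open>T\<^sub>0\<close> spaces.
\<close>

definition ps :: "'a topology \<Rightarrow> ('a + nat) ordinal" where
  "ps X = (LEAST \<beta>. Seeker_wins_separating X \<beta>)"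

definition sm_set :: "'a set \<Rightarrow> 'a topology \<Rightarrow> ('a + nat) ordinal" where
  "sm_set Y X = (LEAST \<beta>. Seeker_wins_membership Y X \<beta>)"

text \<open>The supremum is spelled out as the least upper bound.\<close>

definition sm :: "'a topology \<Rightarrow> ('a + nat) ordinal" where
  "sm X = (LEAST \<beta>. \<forall>Y. Y \<subseteq> topspace X \<longrightarrow> sm_set Y X \<le> \<beta>)"

lemma ex_ord_type_inj:
  fixes A :: "'c set" and B :: "'b set"
  assumes "|A| \<le>o |B|"
  obtains \<beta> :: "'b ordinal" and g :: "'c \<Rightarrow> 'b ordinal" where "inj_on g A" "g ` A \<subseteq> {..<\<beta>}"
proof -
  have "Well_order |B|" by (rule card_of_Well_order)
  then obtain f where f: "bij_betw f (Field |B| ) {..<ord_type |B|}"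
    by (rule ord_type_segment)
  obtain h where "inj_on h A" "h ` A \<subseteq> B"
    using assms by (auto simp: card_of_ordLeq[symmetric])
  with f have "inj_on (f \<circ> h) A" "(f \<circ> h) ` A \<subseteq> {..<ord_type |B|}"
    by (auto simp: bij_betw_def Field_card_of intro: comp_inj_on inj_on_subset)
  then show ?thesis by (rule that)
qed

lemma ex_Seeker_wins_separating:
  fixes X :: "'a topology"
  assumes "t0_space X"
  shows "\<exists>\<beta> :: ('a + nat) ordinal. Seeker_wins_separating X \<beta>"
proof -
  have "|UNIV :: ('a \<times> 'a) set| \<le>o |UNIV :: ('a + nat) set|"
  proof -
    have "|UNIV :: ('a \<times> 'a) set| \<le>o |(UNIV :: ('a + nat) set) \<times> (UNIV :: ('a + nat) set)|"
      by (auto simp: card_of_ordLeq[symmetric] inj_on_def intro!: exI[of _ "map_prod Inl Inl"])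
    moreover have "|(UNIV :: ('a + nat) set) \<times> (UNIV :: ('a + nat) set)| =o |UNIV :: ('a + nat) set|"
      by (rule card_of_Times_same_infinite) simp
    ultimately show ?thesis by (rule ordLeq_ordIso_trans)
  qed
  then obtain \<beta> :: "('a + nat) ordinal" and g :: "'a \<times> 'a \<Rightarrow> ('a + nat) ordinal"
    where g: "inj g" "range g \<subseteq> {..<\<beta>}"
    by (rule ex_ord_type_inj)
  define S where "S = (\<lambda>(x, y). SOME U. openin X U \<and>
    (x \<in> topspace X \<and> y \<in> topspace X \<and> x \<noteq> y \<longrightarrow> (x \<notin> U \<longleftrightarrow> y \<in> U)))"
  have *: "openin X (S (x, y)) \<and> (x \<in> topspace X \<and> y \<in> topspace X \<and> x \<noteq> y \<longrightarrow>
      (x \<notin> S (x, y) \<longleftrightarrow> y \<in> S (x, y)))" for x y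
    unfolding S_def case_prod_conv
    by (rule someI_ex) (use assms openin_empty[of X] in \<open>unfold t0_space_def, blast\<close>)
  have S: "openin X (S p)" for p
    using *[of "fst p" "snd p"] by simp
  let ?\<sigma> = "\<lambda>\<alpha> (h :: ('a + nat) ordinal \<Rightarrow> 'a set \<times> 'a set). S (inv g \<alpha>)"
  have "finite (outcome X \<beta> V) \<and> card (outcome X \<beta> V) \<le> 1"
    if play: "play_following X \<beta> ?\<sigma> U V" for U V
  proof -
    have "x = y" if "x \<in> outcome X \<beta> V" "y \<in> outcome X \<beta> V" for x y
    proof (rule ccontr)
      assume "x \<noteq> y"
      have "g (x, y) < \<beta>" using g by auto
      then have "V (g (x, y)) \<in> {S (x, y), topspace X - S (x, y)}" "x \<in> V (g (x, y))" "y \<in> V (g (x, y))"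
        using play that \<open>inj g\<close> by (auto simp: play_following_def outcome_def)
      moreover have "x \<in> topspace X" "y \<in> topspace X"
        using that by (auto simp: outcome_def)
      ultimately show False
        using *[of x y] \<open>x \<noteq> y\<close> by auto
    qed
    then have "outcome X \<beta> V = {} \<or> (\<exists>x. outcome X \<beta> V = {x})" by blast
    then show ?thesis by auto
  qed
  then have "Seeker_wins_separating X \<beta>"
    unfolding Seeker_wins_separating_def Seeker_wins_def
    using S by (intro exI[of _ ?\<sigma>]) auto
  then show ?thesis ..
qed

lemma Seeker_wins_separating_imp_membership:
  assumes "Seeker_wins_separating X \<beta>"
  shows "Seeker_wins_membership Y X \<beta>"
proof -
  have "W \<subseteq> Y \<or> W \<inter> Y = {}" if "finite W \<and> card W \<le> 1" for W
  proof -
    have "\<forall>x\<in>W. \<forall>y\<in>W. x = y"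
      using that card_le_Suc0_iff_eq[of W] by auto
    then show ?thesis
      by auto
  qed
  note * = this
  obtain \<sigma> where \<sigma>: "\<forall>\<alpha> h. openin X (\<sigma> \<alpha> h)"
    "\<And>U V. play_following X \<beta> \<sigma> U V \<Longrightarrow> finite (outcome X \<beta> V) \<and> card (outcome X \<beta> V) \<le> 1"
    using assms unfolding Seeker_wins_separating_def Seeker_wins_def by blast
  show ?thesis
    unfolding Seeker_wins_membership_def Seeker_wins_def
    by (intro exI[of _ \<sigma>] conjI allI impI \<sigma>(1) *[OF \<sigma>(2)])
qed

context
  fixes X :: "'a topology"
  assumes X: "t0_space X"
begin

lemma Seeker_wins_ps: "Seeker_wins_separating X (ps X)"
  unfolding ps_def by (rule LeastI_ex[OF ex_Seeker_wins_separating[OF X]])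

lemma Seeker_wins_sm_set: "Seeker_wins_membership Y X (sm_set Y X)"
  unfolding sm_set_def
  by (rule LeastI[where P = "Seeker_wins_membership Y X", OF Seeker_wins_separating_imp_membership[OF Seeker_wins_ps]])

lemma sm_set_le_ps: "sm_set Y X \<le> ps X"
  unfolding sm_set_def
  by (rule Least_le[where P = "Seeker_wins_membership Y X", OF Seeker_wins_separating_imp_membership[OF Seeker_wins_ps]])

lemma sm_set_le_sm: "Y \<subseteq> topspace X \<Longrightarrow> sm_set Y X \<le> sm X"
proof -
  let ?P = "\<lambda>\<beta>. \<forall>Y. Y \<subseteq> topspace X \<longrightarrow> sm_set Y X \<le> \<beta>"
  have "?P (ps X)" by (simp add: sm_set_le_ps)
  then have "?P (sm X)" unfolding sm_def by (rule LeastI[where P = ?P])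
  then show "Y \<subseteq> topspace X \<Longrightarrow> sm_set Y X \<le> sm X" by blast
qed

end

lemma clog_works:
  fixes X :: "'a topology"
  shows "is_cardinal (clog |topspace X| :: ('a + nat) ordinal)"
    and "|topspace X| \<le>o ctwo ^c |{..<clog |topspace X| :: ('a + nat) ordinal}|"
proof -
  have "|topspace X| \<le>o |UNIV :: ('a + nat) set|"
    by (auto simp: card_of_ordLeq[symmetric] inj_on_def)
  then obtain \<beta> :: "('a + nat) ordinal" and g :: "'a \<Rightarrow> ('a + nat) ordinal"
    where g: "inj_on g (topspace X)" "g ` topspace X \<subseteq> {..<\<beta>}"
    by (rule ex_ord_type_inj)
  let ?P = "\<lambda>\<beta> :: ('a + nat) ordinal. |topspace X| \<le>o |{..<\<beta>}|"
  define \<mu> where "\<mu> = (LEAST \<beta>. ?P \<beta>)"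
  have "?P \<beta>"
    using g by (auto simp: card_of_ordLeq[symmetric])
  then have \<mu>: "?P \<mu>"
    unfolding \<mu>_def by (rule LeastI[where P = ?P])
  have "|{..<\<alpha>}| <o |{..<\<mu>}|" if "\<alpha> < \<mu>" for \<alpha>
  proof -
    have "\<not> ?P \<alpha>"
      using that unfolding \<mu>_def by (rule not_less_Least[where P = ?P])
    then have "|{..<\<alpha>}| <o |topspace X|"
      by (simp only: not_ordLeq_iff_ordLess[OF card_of_Well_order card_of_Well_order] simp_thms)
    then show ?thesis
      using \<mu> by (rule ordLess_ordLeq_trans)
  qed
  then have "is_cardinal \<mu>"
    by (simp add: is_cardinal_def)
  moreover have "|topspace X| \<le>o ctwo ^c |{..<\<mu>}|"
  proof -
    have "|{..<\<mu>}| \<le>o ctwo ^c |{..<\<mu>}|"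
      by (rule ordLeq_cexp2[OF ordLeq_refl[OF Card_order_ctwo] card_of_Card_order])
    with \<mu> show ?thesis by (rule ordLeq_transitive)
  qed
  ultimately have ex: "is_cardinal \<mu> \<and> |topspace X| \<le>o ctwo ^c |{..<\<mu>}|" ..
  let ?Q = "\<lambda>\<mu> :: ('a + nat) ordinal. is_cardinal \<mu> \<and> |topspace X| \<le>o ctwo ^c |{..<\<mu>}|"
  have "?Q (clog |topspace X| )"
    unfolding clog_def using ex by (rule LeastI[where P = ?Q])
  then show "is_cardinal (clog |topspace X| :: ('a + nat) ordinal)"
    and "|topspace X| \<le>o ctwo ^c |{..<clog |topspace X| :: ('a + nat) ordinal}|"
    by auto
qed

end

theory Submission
  imports Defs
begin

text \<open>
  Upper bound: an injective coding of the points by subsets of \<open>log |X|\<close> yields \<open>log |X|\<close> subsets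
  of \<open>X\<close> that separate points. The Seeker plays the membership games of all of them
  simultaneously, each on its own piece of a decomposition of \<open>\<delta>\<close>.
  Lower bound: a winning strategy of length \<open>\<beta>\<close> in the point separating game codes a point \<open>x\<close> by
  the Hider's choices in the play in which he keeps \<open>x\<close>, whence \<open>|X| \<le> 2\<^sup>|\<^sup>\<beta>\<^sup>|\<close>.
\<close>

section \<open>Powers of two and monotonicity of the games\<close>

lemma ctwo_cexp_card_of: "ctwo ^c |A| =o |Pow A|"
  unfolding ctwo_def cexp_def Field_card_of by (rule ordIso_symmetric[OF card_of_Pow_Func])

lemma outcome_antimono: "\<alpha> \<le> \<beta> \<Longrightarrow> outcome X \<beta> V \<subseteq> outcome X \<alpha> V"
  by (auto simp: outcome_def)

lemma Seeker_wins_weaken: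
  assumes "Seeker_wins X \<beta> win" and "\<And>W. win W \<Longrightarrow> win' W"
  shows "Seeker_wins X \<beta> win'"
  using assms(1) unfolding Seeker_wins_def
  by (elim exE, rule_tac x = \<sigma> in exI) (auto intro!: assms(2))

text \<open>The same strategy works: the first \<open>\<beta>\<close> moves already form a play of
  the shorter game, and further moves can only shrink the outcome.\<close>

lemma Seeker_wins_mono:
  assumes win: "Seeker_wins X \<beta> win" and "\<beta> \<le> \<delta>"
    and hereditary: "\<And>W W'. win W \<Longrightarrow> W' \<subseteq> W \<Longrightarrow> win W'"
  shows "Seeker_wins X \<delta> win"
proof -
  obtain \<sigma> where \<sigma>: "\<And>\<alpha> h. openin X (\<sigma> \<alpha> h)"
    "\<And>U V. play_following X \<beta> \<sigma> U V \<Longrightarrow> win (outcome X \<beta> V)"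
    using win unfolding Seeker_wins_def by blast
  have "win (outcome X \<delta> V)" if "play_following X \<delta> \<sigma> U V" for U V
  proof (rule hereditary)
    have "play_following X \<beta> \<sigma> U V"
      using that order_less_le_trans[OF _ \<open>\<beta> \<le> \<delta>\<close>] unfolding play_following_def by blast
    then show "win (outcome X \<beta> V)"
      by (rule \<sigma>(2))
  qed (rule outcome_antimono[OF \<open>\<beta> \<le> \<delta>\<close>])
  then show ?thesis
    unfolding Seeker_wins_def using \<sigma>(1) by blast
qed

section \<open>Many games at once, and the upper bound\<close>

text \<open>Since \<open>A i\<close> is a copy of \<open>\<delta>\<close>, the moves made at indices
  in \<open>A i\<close> form a complete play of length \<open>\<delta>\<close>, in which the Seeker
  can use a winning strategy of game \<open>i\<close>, ignoring all other moves. The joint outcome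
  lies in the outcome of each of these plays, so heredity transfers the win.\<close>

lemma Seeker_wins_simultaneous:
  fixes \<delta> :: "'b ordinal"
  assumes disj: "disjoint_family_on A I"
    and sub: "\<And>i. i \<in> I \<Longrightarrow> A i \<subseteq> {..<\<delta>}"
    and type: "\<And>i. i \<in> I \<Longrightarrow> has_order_type (A i) \<delta>"
    and win: "\<And>i. i \<in> I \<Longrightarrow> Seeker_wins X \<delta> (win i)"
    and hereditary: "\<And>i W W'. i \<in> I \<Longrightarrow> win i W \<Longrightarrow> W' \<subseteq> W \<Longrightarrow> win i W'"
  shows "Seeker_wins X \<delta> (\<lambda>W. W \<subseteq> topspace X \<and> (\<forall>i\<in>I. win i W))"
proof -
  obtain \<sigma> where \<sigma>: "\<And>i \<alpha> h. i \<in> I \<Longrightarrow> openin X (\<sigma> i \<alpha> h)"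
    "\<And>i U V. i \<in> I \<Longrightarrow> play_following X \<delta> (\<sigma> i) U V \<Longrightarrow> win i (outcome X \<delta> V)"
    using win unfolding Seeker_wins_def by metis
  obtain f where f: "\<And>i. i \<in> I \<Longrightarrow> bij_betw (f i) (A i) {..<\<delta>}"
    "\<And>i. i \<in> I \<Longrightarrow> strict_mono_on (A i) (f i)"
    using type unfolding has_order_type_def by metis
  define g where "g i = inv_into (A i) (f i)" for i
  have gA: "g i \<xi> \<in> A i" and fg: "f i (g i \<xi>) = \<xi>" if "i \<in> I" "\<xi> < \<delta>" for i \<xi>
    using f(1)[OF that(1)] that(2)
    by (auto simp: g_def bij_betw_def intro: inv_into_into f_inv_into_f)
  \<comment> \<open>Monotonicity of the enumeration \<open>g i\<close> of \<open>A i\<close> ensures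
    that all earlier moves of game \<open>i\<close> are known when its next move is due.\<close>
  have g_less: "g i \<xi> < g i \<eta>" if "i \<in> I" "\<xi> < \<eta>" "\<eta> < \<delta>" for i \<xi> \<eta>
  proof (rule ccontr)
    assume "\<not> g i \<xi> < g i \<eta>"
    moreover have "\<xi> < \<delta>" using that by simp
    ultimately have "f i (g i \<eta>) \<le> f i (g i \<xi>)"
      using strict_mono_on_leD[OF f(2)[OF that(1)] gA[OF that(1,3)] gA[OF that(1)]] by simp
    with that \<open>\<xi> < \<delta>\<close> show False by (simp add: fg)
  qed
  define idx where "idx \<alpha> = (SOME i. i \<in> I \<and> \<alpha> \<in> A i)" for \<alpha>
  have idx: "idx \<alpha> = i" if "i \<in> I" "\<alpha> \<in> A i" for i \<alpha>
  proof -
    have "idx \<alpha> \<in> I \<and> \<alpha> \<in> A (idx \<alpha>)"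
      unfolding idx_def by (rule someI) (use that in auto)
    with that disj show ?thesis by (auto simp: disjoint_family_on_def)
  qed
  \<comment> \<open>The history is pulled back along \<open>g i\<close> to a history of game
    \<open>i\<close>. At an index in no piece \<open>idx\<close> is arbitrary, but the set played is
    still open and no game reads that move.\<close>
  define \<tau> where "\<tau> \<alpha> h = (let i = idx \<alpha> in
    if i \<in> I then \<sigma> i (f i \<alpha>) (restrict (\<lambda>\<xi>. h (g i \<xi>)) {..<f i \<alpha>}) else {})" for \<alpha> h
  have "win i (outcome X \<delta> V)" if play: "play_following X \<delta> \<tau> U V" and i: "i \<in> I" for U V i
  proof (rule hereditary[OF i])
    have "play_following X \<delta> (\<sigma> i) (U \<circ> g i) (V \<circ> g i)"
      unfolding play_following_def
    proof (intro allI impI)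
      fix \<alpha> assume \<alpha>: "\<alpha> < \<delta>"
      have *: "g i \<alpha> < \<delta>" using gA[OF i \<alpha>] sub[OF i] by auto
      \<comment> \<open>The inner restriction is harmless because
        \<open>g i \<xi> < g i \<alpha>\<close> for \<open>\<xi> < \<alpha>\<close>.\<close>
      have "restrict (\<lambda>\<xi>. restrict (\<lambda>\<xi>. (U \<xi>, V \<xi>)) {..<g i \<alpha>} (g i \<xi>)) {..<\<alpha>}
          = restrict (\<lambda>\<xi>. ((U \<circ> g i) \<xi>, (V \<circ> g i) \<xi>)) {..<\<alpha>}"
        using g_less[OF i _ \<alpha>] by (auto simp: restrict_def)
      then have "\<tau> (g i \<alpha>) (restrict (\<lambda>\<xi>. (U \<xi>, V \<xi>)) {..<g i \<alpha>})
          = \<sigma> i \<alpha> (restrict (\<lambda>\<xi>. ((U \<circ> g i) \<xi>, (V \<circ> g i) \<xi>)) {..<\<alpha>})"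
        by (simp add: \<tau>_def Let_def idx[OF i gA[OF i \<alpha>]] i fg[OF i \<alpha>])
      moreover have "U (g i \<alpha>) = \<tau> (g i \<alpha>) (restrict (\<lambda>\<xi>. (U \<xi>, V \<xi>)) {..<g i \<alpha>})"
        "V (g i \<alpha>) \<in> {U (g i \<alpha>), topspace X - U (g i \<alpha>)}"
        using play * unfolding play_following_def by blast+
      ultimately show "(U \<circ> g i) \<alpha> = \<sigma> i \<alpha> (restrict (\<lambda>\<xi>. ((U \<circ> g i) \<xi>, (V \<circ> g i) \<xi>)) {..<\<alpha>})
          \<and> (V \<circ> g i) \<alpha> \<in> {(U \<circ> g i) \<alpha>, topspace X - (U \<circ> g i) \<alpha>}"
        by simp
    qed
    then show "win i (outcome X \<delta> (V \<circ> g i))"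
      by (rule \<sigma>(2)[OF i])
    show "outcome X \<delta> V \<subseteq> outcome X \<delta> (V \<circ> g i)"
      using gA[OF i] sub[OF i] by (fastforce simp: outcome_def)
  qed
  moreover have "openin X (\<tau> \<alpha> h)" for \<alpha> h
    by (simp add: \<tau>_def Let_def \<sigma>(1))
  moreover have "outcome X \<delta> V \<subseteq> topspace X" for V
    by (auto simp: outcome_def)
  ultimately show ?thesis
    unfolding Seeker_wins_def by blast
qed

lemma Seeker_wins_separating_decomposable:
  fixes X :: "'a topology" and \<delta> \<kappa> :: "'b ordinal"
  assumes mem: "\<And>Y. Y \<subseteq> topspace X \<Longrightarrow> Seeker_wins_membership Y X \<delta>"
    and card: "|topspace X| \<le>o ctwo ^c |{..<\<kappa>}|"
    and dec: "decomposable \<kappa> \<delta>"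
  shows "Seeker_wins_separating X \<delta>"
proof -
  obtain P where P: "disjoint P" "\<Union>P = {..<\<delta>}" "|P| =o |{..<\<kappa>}|"
    "\<forall>A\<in>P. has_order_type A \<delta>"
    using dec unfolding decomposable_def by (elim exE conjE)
  \<comment> \<open>One piece of the decomposition for each bit position of the codes below.\<close>
  obtain p where p: "bij_betw p {..<\<kappa>} P"
    using ordIso_symmetric[OF P(3)] by (auto simp: card_of_ordIso[symmetric])
  have "|topspace X| \<le>o |Pow {..<\<kappa>}|"
    using card ctwo_cexp_card_of by (rule ordLeq_ordIso_trans)
  then obtain c where c: "inj_on c (topspace X)" "c ` topspace X \<subseteq> Pow {..<\<kappa>}"
    by (auto simp: card_of_ordLeq[symmetric])
  \<comment> \<open>Deciding membership in every \<open>Y i\<close> fixes every bit of the code, so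
    an outcome contains at most one point.\<close>
  define Y where "Y i = {x \<in> topspace X. i \<in> c x}" for i
  have "Seeker_wins X \<delta> (\<lambda>W. W \<subseteq> topspace X \<and> (\<forall>i\<in>{..<\<kappa>}. W \<subseteq> Y i \<or> W \<inter> Y i = {}))"
  proof (rule Seeker_wins_simultaneous)
    show "disjoint_family_on p {..<\<kappa>}"
      using p P(1) by (simp add: bij_betw_def disjoint_image_disjoint_family_on)
    fix i assume "i \<in> {..<\<kappa>}"
    then have "p i \<in> P" using p by (auto simp: bij_betw_def)
    then show "p i \<subseteq> {..<\<delta>}" "has_order_type (p i) \<delta>"
      using P(2,4) by auto
    show "Seeker_wins X \<delta> (\<lambda>W. W \<subseteq> Y i \<or> W \<inter> Y i = {})"
      using mem[of "Y i"] by (auto simp: Seeker_wins_membership_def Y_def)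
  qed auto
  moreover have "finite W \<and> card W \<le> 1"
    if W: "W \<subseteq> topspace X \<and> (\<forall>i\<in>{..<\<kappa>}. W \<subseteq> Y i \<or> W \<inter> Y i = {})" for W
  proof -
    have "x = y" if "x \<in> W" "y \<in> W" for x y
    proof -
      have xy: "x \<in> topspace X" "y \<in> topspace X" using W that by auto
      have "i \<in> c x \<longleftrightarrow> i \<in> c y" if "i < \<kappa>" for i
        using W that \<open>x \<in> W\<close> \<open>y \<in> W\<close> by (auto simp: Y_def)
      moreover have "c x \<subseteq> {..<\<kappa>}" "c y \<subseteq> {..<\<kappa>}" using c(2) xy by auto
      ultimately have "c x = c y" by blast
      with c(1) xy show "x = y" by (auto simp: inj_on_def)
    qed
    then have "W = {} \<or> (\<exists>x. W = {x})" by blast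
    then show ?thesis by auto
  qed
  ultimately show ?thesis
    unfolding Seeker_wins_separating_def by (rule Seeker_wins_weaken)
qed

section \<open>The lower bound for the length of the point separating game\<close>

text \<open>Against a fixed strategy, the Hider who always keeps \<open>x\<close> determines a play
  by well-founded recursion on the move index. The last conclusion records his rule, from which
  plays of different points are compared later.\<close>

lemma ex_play_keeping_point:
  fixes X :: "'a topology" and \<beta> :: "'b ordinal"
  obtains U V where "\<And>x. x \<in> topspace X \<Longrightarrow> play_following X \<beta> \<sigma> (U x) (V x)"
    "\<And>x. x \<in> topspace X \<Longrightarrow> x \<in> outcome X \<beta> (V x)"
    "\<And>x \<alpha>. V x \<alpha> = (if x \<in> U x \<alpha> then U x \<alpha> else topspace X - U x \<alpha>)"
proof -
  define F where "F x rec \<alpha> = (let u = \<sigma> \<alpha> (restrict rec {..<\<alpha>})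
    in (u, if x \<in> u then u else topspace X - u))" for x rec \<alpha>
  define m where "m x = wfrec {(\<alpha>, \<beta> :: 'b ordinal). \<alpha> < \<beta>} (F x)" for x
  \<comment> \<open>\<open>F x\<close> reads only values below \<open>\<alpha>\<close>, so the
    recursion satisfies its equation without a cut-off.\<close>
  have "adm_wf {(\<alpha>, \<beta> :: 'b ordinal). \<alpha> < \<beta>} (F x)" for x
    unfolding adm_wf_def
  proof (intro allI impI)
    fix h k :: "'b ordinal \<Rightarrow> 'a set \<times> 'a set" and \<alpha> :: "'b ordinal"
    assume "\<forall>\<xi>. (\<xi>, \<alpha>) \<in> {(\<alpha>, \<beta>). \<alpha> < \<beta>} \<longrightarrow> h \<xi> = k \<xi>"
    then have "restrict h {..<\<alpha>} = restrict k {..<\<alpha>}"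
      by (auto simp: restrict_def)
    then show "F x h \<alpha> = F x k \<alpha>" by (simp add: F_def)
  qed
  then have m: "m x \<alpha> = F x (m x) \<alpha>" for x \<alpha>
    unfolding m_def by (subst wfrec_fixpoint[OF wf]) auto
  define U V where "U x = fst \<circ> m x" and "V x = snd \<circ> m x" for x
  have UV: "(\<lambda>\<xi>. (U x \<xi>, V x \<xi>)) = m x" for x
    by (simp add: U_def V_def)
  have U: "U x \<alpha> = \<sigma> \<alpha> (restrict (\<lambda>\<xi>. (U x \<xi>, V x \<xi>)) {..<\<alpha>})" for x \<alpha>
    unfolding UV by (simp add: U_def m[of x \<alpha>] F_def Let_def)
  have V: "V x \<alpha> = (if x \<in> U x \<alpha> then U x \<alpha> else topspace X - U x \<alpha>)" for x \<alpha>
    by (simp add: U_def V_def m[of x \<alpha>] F_def Let_def)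
  show ?thesis
  proof (rule that)
    show "play_following X \<beta> \<sigma> (U x) (V x)" for x
      unfolding play_following_def
    proof (intro allI impI conjI)
      show "V x \<alpha> \<in> {U x \<alpha>, topspace X - U x \<alpha>}" for \<alpha>
        by (simp add: V)
    qed (rule U)
    show "x \<in> outcome X \<beta> (V x)" if "x \<in> topspace X" for x
      using that by (auto simp: outcome_def V)
  qed (rule V)
qed

lemma Seeker_wins_separating_imp_card:
  fixes \<beta> :: "'b ordinal"
  assumes "Seeker_wins_separating X \<beta>"
  shows "|topspace X| \<le>o ctwo ^c |{..<\<beta>}|"
proof -
  obtain \<sigma> where \<sigma>:
    "\<And>U V. play_following X \<beta> \<sigma> U V \<Longrightarrow> finite (outcome X \<beta> V) \<and> card (outcome X \<beta> V) \<le> 1"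
    using assms unfolding Seeker_wins_separating_def Seeker_wins_def by blast
  obtain U V where play: "\<And>x. x \<in> topspace X \<Longrightarrow> play_following X \<beta> \<sigma> (U x) (V x)"
    and out: "\<And>x. x \<in> topspace X \<Longrightarrow> x \<in> outcome X \<beta> (V x)"
    and V: "\<And>x \<alpha>. V x \<alpha> = (if x \<in> U x \<alpha> then U x \<alpha> else topspace X - U x \<alpha>)"
    by (rule ex_play_keeping_point[of X \<beta> \<sigma>]) blast
  define c where "c x = {\<alpha>. \<alpha> < \<beta> \<and> x \<in> U x \<alpha>}" for x
  have "inj_on c (topspace X)"
  proof (rule inj_onI)
    fix x y assume x: "x \<in> topspace X" and y: "y \<in> topspace X" and c: "c x = c y"
    \<comment> \<open>Equal histories force the same set from the Seeker, and equal codes then force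
      the same answer. Hence both points survive in one outcome.\<close>
    have same: "U x \<alpha> = U y \<alpha> \<and> V x \<alpha> = V y \<alpha>" if "\<alpha> < \<beta>" for \<alpha>
      using that
    proof (induction \<alpha> rule: less_induct)
      case (less \<alpha>)
      then have "restrict (\<lambda>\<xi>. (U x \<xi>, V x \<xi>)) {..<\<alpha>} = restrict (\<lambda>\<xi>. (U y \<xi>, V y \<xi>)) {..<\<alpha>}"
        by (auto simp: restrict_def)
      then have "U x \<alpha> = U y \<alpha>"
        using play[OF x] play[OF y] less.prems by (simp add: play_following_def)
      moreover have "x \<in> U x \<alpha> \<longleftrightarrow> y \<in> U y \<alpha>"
        using c less.prems by (auto simp: c_def)
      ultimately show ?case
        by (simp add: V)
    qed
    then have "outcome X \<beta> (V x) = outcome X \<beta> (V y)"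
      by (auto simp: outcome_def)
    then have "x \<in> outcome X \<beta> (V x)" "y \<in> outcome X \<beta> (V x)"
      using out x y by auto
    with \<sigma>[OF play[OF x]] show "x = y"
      by (auto simp: card_le_Suc0_iff_eq)
  qed
  moreover have "c ` topspace X \<subseteq> Pow {..<\<beta>}"
    by (auto simp: c_def)
  ultimately have "|topspace X| \<le>o |Pow {..<\<beta>}|"
    by (auto simp: card_of_ordLeq[symmetric])
  then show ?thesis
    using ordIso_symmetric[OF ctwo_cexp_card_of] by (rule ordLeq_ordIso_trans)
qed

text \<open>\<open>clog\<close> minimizes over cardinals only, while \<open>\<beta>\<close> may be
  any ordinal. The least ordinal \<open>\<mu>\<close> whose segment is at least as large as that of
  \<open>\<beta>\<close> is a cardinal below or equal to \<open>\<beta>\<close>, and it gives an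
  exponent that is just as good.\<close>

lemma clog_le:
  fixes \<beta> :: "'b ordinal"
  assumes "\<kappa> \<le>o ctwo ^c |{..<\<beta>}|"
  shows "clog \<kappa> \<le> \<beta>"
proof -
  let ?P = "\<lambda>\<alpha>. |{..<\<beta>}| \<le>o |{..<\<alpha> :: 'b ordinal}|"
  define \<mu> where "\<mu> = (LEAST \<alpha>. ?P \<alpha>)"
  have refl: "?P \<beta>" by (rule ordLeq_refl[OF card_of_Card_order])
  then have \<mu>: "?P \<mu>"
    unfolding \<mu>_def by (rule LeastI[where P = ?P])
  have le: "\<mu> \<le> \<beta>"
    unfolding \<mu>_def using refl by (rule Least_le[where P = ?P])
  have "|{..<\<alpha>}| <o |{..<\<mu>}|" if "\<alpha> < \<mu>" for \<alpha>
  proof -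
    have "\<not> ?P \<alpha>"
      using that unfolding \<mu>_def by (rule not_less_Least[where P = ?P])
    then have "|{..<\<alpha>}| <o |{..<\<beta>}|"
      by (simp only: not_ordLeq_iff_ordLess[OF card_of_Well_order card_of_Well_order] simp_thms)
    then show ?thesis
      using \<mu> by (rule ordLess_ordLeq_trans)
  qed
  then have "is_cardinal \<mu>"
    by (simp add: is_cardinal_def)
  moreover have "ctwo ^c |{..<\<beta>}| \<le>o ctwo ^c |{..<\<mu>}|"
  \<comment> \<open>The side condition on empty exponents follows from
    \<open>\<mu> \<le> \<beta>\<close>.\<close>
  proof (rule cexp_mono2'[OF \<mu> Card_order_ctwo])
    have "{..<\<mu>} \<subseteq> {..<\<beta>}" using le by auto
    then show "Field |{..<\<beta>}| = {} \<Longrightarrow> Field |{..<\<mu>}| = {}"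
      by (simp add: Field_card_of)
  qed
  then have "\<kappa> \<le>o ctwo ^c |{..<\<mu>}|"
    by (rule ordLeq_transitive[OF assms])
  ultimately have "clog \<kappa> \<le> \<mu>"
    unfolding clog_def by (intro Least_le conjI)
  with le show ?thesis by simp
qed

theorem theorem2p2:
  fixes X :: "'a topology" and \<delta> :: "('a + nat) ordinal"
  assumes "t0_space X"
    and "\<delta> = max (sm X) (clog |topspace X| )"
    and "decomposable (clog |topspace X| ) \<delta>"
  shows "ps X = \<delta>"
proof (rule antisym)
  have "Seeker_wins_membership Y X \<delta>" if "Y \<subseteq> topspace X" for Y
    unfolding Seeker_wins_membership_def
  \<comment> \<open>Winning a membership game is hereditary in the outcome, so a win in
    \<open>sm_set Y X\<close> moves extends to \<open>\<delta>\<close>.\<close>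
  proof (rule Seeker_wins_mono)
    show "Seeker_wins X (sm_set Y X) (\<lambda>W. W \<subseteq> Y \<or> W \<inter> Y = {})"
      using Seeker_wins_sm_set[OF assms(1)] by (simp add: Seeker_wins_membership_def)
    show "sm_set Y X \<le> \<delta>"
      using sm_set_le_sm[OF assms(1) that] assms(2) by (simp add: le_max_iff_disj)
  qed auto
  then have "Seeker_wins_separating X \<delta>"
    using clog_works(2) assms(3) by (rule Seeker_wins_separating_decomposable)
  then show "ps X \<le> \<delta>"
    unfolding ps_def by (rule Least_le)
  \<comment> \<open>A strategy that separates points also decides membership in every
    \<open>Y\<close>, so \<open>ps X\<close> is an upper bound in the definition of
    \<open>sm\<close>.\<close>
  have "sm X \<le> ps X"
    unfolding sm_def by (rule Least_le) (simp add: sm_set_le_ps[OF assms(1)])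
  moreover have "clog |topspace X| \<le> ps X"
    by (intro clog_le Seeker_wins_separating_imp_card Seeker_wins_ps assms(1))
  ultimately show "\<delta> \<le> ps X"
    using assms(2) by simp
qed

end
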